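(* Let $M=(m_{ij})$ be a real symmetric $d\times d$ matrix and let $\mathbf{z}\in\mathbb{R}^d$ be a random vector with i.i.d. Rademacher entries (each equal to $+1$ or $-1$ with probability $1/2$). Then $$\operatorname{Var}(\mathbf{z}^{\mathsf T}M\mathbf{z})=2\sum_{i\neq j}m_{ij}^2=2\Bigl(\|M\|_F^2-\sum_i m_{ii}^2\Bigr),$$ where $\|\cdot\|_F$ is the Frobenius norm and the first sum runs over all ordered pairs $(i,j)$ with $i\ne j$. *)

theory Defs
  imports "HOL-Probability.Probability"
begin

definition frobenius_norm :: "real ^ 'n ^ 'm \<Rightarrow> real" where
  "frobenius_norm A = sqrt (\<Sum>i\<in>UNIV. \<Sum>j\<in>UNIV. (A $ i $ j)\<^sup>2)"

text \<open>The library norm on \<^typ>\<open>real ^ 'n ^ 'm\<close> (the Euclidean norm of the vector of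
  Euclidean row norms) is the Frobenius norm, not an operator norm.\<close>

lemma frobenius_norm_eq_norm: "frobenius_norm A = norm A"
  by (simp add: frobenius_norm_def norm_vec_def L2_set_def sum_nonneg)

definition rademacher :: "'a measure \<Rightarrow> ('a \<Rightarrow> real) \<Rightarrow> bool" where
  "rademacher P X \<longleftrightarrow> X \<in> borel_measurable P \<and>
     measure P {\<omega> \<in> space P. X \<omega> = 1} = 1 / 2 \<and>
     measure P {\<omega> \<in> space P. X \<omega> = -1} = 1 / 2"

text \<open>A random vector is a Borel measurable map into \<^typ>\<open>real ^ 'd\<close>. The entries are
  identically distributed since all of them are Rademacher, which determines the law.\<close>

definition rademacher_vector :: "'a measure \<Rightarrow> ('a \<Rightarrow> real ^ 'd) \<Rightarrow> bool" where
  "rademacher_vector P z \<longleftrightarrow> z \<in> borel_measurable P \<and>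
     prob_space.indep_vars P (\<lambda>_. borel) (\<lambda>i \<omega>. z \<omega> $ i) UNIV \<and>
     (\<forall>i. rademacher P (\<lambda>\<omega>. z \<omega> $ i))"

end

theory Submission
  imports Defs
begin

text \<open>The Walsh monomials \<open>\<Prod>i\<in>S. z\<^sub>i\<close> are orthonormal, because the product of those for
  \<open>S\<close> and \<open>T\<close> is almost surely that for the symmetric difference. Since \<open>z\<^sub>i\<^sup>2 = 1\<close> almost
  surely, the quadratic form minus its trace is a combination of the monomials for
  \<open>{i, j}\<close> with \<open>i \<noteq> j\<close>. Each of these occurs twice, for \<open>(i, j)\<close> and \<open>(j, i)\<close>,
  which by symmetry of the matrix gives the factor 2.\<close>

context prob_space
begin

text \<open>The two atoms are disjoint and carry mass 1/2 each, so no mass is left for any other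
  value.\<close>

lemma rademacher_AE:
  assumes "rademacher M X"
  shows "AE \<omega> in M. X \<omega> = 1 \<or> X \<omega> = -1"
proof -
  have [measurable]: "X \<in> borel_measurable M"
    using assms by (simp add: rademacher_def)
  have "prob ({\<omega> \<in> space M. X \<omega> = 1} \<union> {\<omega> \<in> space M. X \<omega> = -1}) = 1"
    using assms by (subst finite_measure_Union) (auto simp: rademacher_def)
  then have "AE \<omega> in M. \<omega> \<in> {\<omega> \<in> space M. X \<omega> = 1} \<union> {\<omega> \<in> space M. X \<omega> = -1}"
    by (rule AE_prob_1)
  then show ?thesis
    by eventually_elim auto
qed

lemma rademacher_integrable:
  assumes "rademacher M X"
  shows "integrable M X"
proof (rule integrable_const_bound[where B = 1])
  show "AE \<omega> in M. norm (X \<omega>) \<le> 1"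
    using rademacher_AE[OF assms] by eventually_elim auto
qed (use assms in \<open>simp add: rademacher_def\<close>)

lemma rademacher_expectation:
  assumes "rademacher M X"
  shows "expectation X = 0"
proof -
  have [measurable]: "X \<in> borel_measurable M"
    using assms by (simp add: rademacher_def)
  let ?A = "{\<omega> \<in> space M. X \<omega> = 1}"
  \<comment> \<open>On the values 1 and -1 the variable is an affine function of the indicator of
    \<open>?A\<close>, so the mean needs only the mass of one atom.\<close>
  have "expectation X = expectation (\<lambda>\<omega>. 2 * indicator ?A \<omega> - 1)"
  proof (rule integral_cong_AE)
    show "AE \<omega> in M. X \<omega> = 2 * indicator ?A \<omega> - 1"
      using rademacher_AE[OF assms] AE_space
      by eventually_elim (auto simp: indicator_def)
  qed auto
  also have "\<dots> = 2 * prob ?A - 1"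
  proof -
    have "integrable M (indicator ?A :: 'a \<Rightarrow> real)"
      by (intro integrable_real_indicator) (auto simp: emeasure_eq_measure)
    then show ?thesis
      by (simp add: prob_space)
  qed
  finally show ?thesis
    using assms by (simp add: rademacher_def)
qed

lemma walsh_integrable:
  assumes "\<And>i. i \<in> S \<Longrightarrow> rademacher M (X i)" "finite S"
  shows "integrable M (\<lambda>\<omega>. \<Prod>i\<in>S. X i \<omega>)"
proof (rule integrable_const_bound[where B = 1])
  have "AE \<omega> in M. \<forall>i\<in>S. X i \<omega> = 1 \<or> X i \<omega> = -1"
    using assms by (intro AE_finite_allI rademacher_AE)
  then show "AE \<omega> in M. norm (\<Prod>i\<in>S. X i \<omega>) \<le> 1"
    by eventually_elim (auto simp: abs_prod intro!: prod_le_1)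
  show "(\<lambda>\<omega>. \<Prod>i\<in>S. X i \<omega>) \<in> borel_measurable M"
    using assms by (intro borel_measurable_prod) (simp add: rademacher_def)
qed

text \<open>Independence factors the expectation into means that are all 0; only the empty product
  survives.\<close>

lemma walsh_expectation:
  assumes "indep_vars (\<lambda>_. borel) X S" "\<And>i. i \<in> S \<Longrightarrow> rademacher M (X i)" "finite S"
  shows "expectation (\<lambda>\<omega>. \<Prod>i\<in>S. X i \<omega>) = (if S = {} then 1 else 0)"
proof -
  have "expectation (\<lambda>\<omega>. \<Prod>i\<in>S. X i \<omega>) = (\<Prod>i\<in>S. expectation (X i))"
    if "S \<noteq> {}"
    using assms that by (intro indep_vars_lebesgue_integral rademacher_integrable)
  then show ?thesis
    using assms by (auto simp: rademacher_expectation prod_zero_iff prob_space)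
qed

text \<open>Indices in \<open>S \<inter> T\<close> occur in both products and contribute squares of
  signs, which are almost surely 1.\<close>

lemma walsh_mult_AE:
  assumes "\<And>i. i \<in> S \<union> T \<Longrightarrow> rademacher M (X i)" "finite S" "finite T"
  shows "AE \<omega> in M. (\<Prod>i\<in>S. X i \<omega>) * (\<Prod>i\<in>T. X i \<omega>) = (\<Prod>i\<in>sym_diff S T. X i \<omega>)"
proof -
  have "AE \<omega> in M. \<forall>i\<in>S \<union> T. X i \<omega> = 1 \<or> X i \<omega> = -1"
    using assms by (intro AE_finite_allI rademacher_AE) auto
  then show ?thesis
  proof eventually_elim
    fix \<omega>
    assume sgn: "\<forall>i\<in>S \<union> T. X i \<omega> = 1 \<or> X i \<omega> = -1"
    let ?p = "\<lambda>A. \<Prod>i\<in>A. X i \<omega>"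
    have "?p S = ?p (S - T) * ?p (S \<inter> T)" "?p T = ?p (T - S) * ?p (S \<inter> T)"
      using prod.Int_Diff[OF assms(2), of "\<lambda>i. X i \<omega>" T]
        prod.Int_Diff[OF assms(3), of "\<lambda>i. X i \<omega>" S]
      by (simp_all add: mult.commute Int_commute)
    moreover have "?p (S \<inter> T) * ?p (S \<inter> T) = 1"
      unfolding prod.distrib[symmetric]
    proof (intro prod.neutral ballI)
      fix i
      assume "i \<in> S \<inter> T"
      then have "X i \<omega> = 1 \<or> X i \<omega> = -1"
        using sgn by blast
      then show "X i \<omega> * X i \<omega> = 1"
        by auto
    qed
    moreover have "?p (sym_diff S T) = ?p (S - T) * ?p (T - S)"
      using assms by (intro prod.union_disjoint) auto
    ultimately show "?p S * ?p T = ?p (sym_diff S T)"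
      by (simp add: algebra_simps)
  qed
qed

text \<open>The symmetric difference is empty exactly when \<open>S = T\<close>, so
  \<open>walsh_expectation\<close> decides both cases. Integrability is recorded as well, since
  expanding the variance termwise requires it.\<close>

lemma walsh_orthonormal:
  assumes indep: "indep_vars (\<lambda>_. borel) X (S \<union> T)"
    and rad: "\<And>i. i \<in> S \<union> T \<Longrightarrow> rademacher M (X i)"
    and fin: "finite S" "finite T"
  shows "integrable M (\<lambda>\<omega>. (\<Prod>i\<in>S. X i \<omega>) * (\<Prod>i\<in>T. X i \<omega>))"
    and "expectation (\<lambda>\<omega>. (\<Prod>i\<in>S. X i \<omega>) * (\<Prod>i\<in>T. X i \<omega>)) = (if S = T then 1 else 0)"
proof -
  let ?f = "\<lambda>\<omega>. (\<Prod>i\<in>S. X i \<omega>) * (\<Prod>i\<in>T. X i \<omega>)"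
  let ?g = "\<lambda>\<omega>. \<Prod>i\<in>sym_diff S T. X i \<omega>"
  have AE: "AE \<omega> in M. ?f \<omega> = ?g \<omega>"
    using rad fin by (rule walsh_mult_AE)
  have f: "?f \<in> borel_measurable M"
    using rad by (intro borel_measurable_times borel_measurable_prod) (auto simp: rademacher_def)
  have g: "integrable M ?g"
    using rad fin by (intro walsh_integrable) auto
  show "integrable M ?f"
    using integrable_cong_AE[OF f borel_measurable_integrable[OF g] AE] g by simp
  have "expectation ?f = expectation ?g"
    using f borel_measurable_integrable[OF g] AE by (rule integral_cong_AE)
  also have "\<dots> = (if sym_diff S T = {} then 1 else 0)"
    using rad fin by (intro walsh_expectation indep_vars_subset[OF indep]) auto
  finally show "expectation ?f = (if S = T then 1 else 0)"
    by auto
qed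

end

text \<open>Decides when two ordered pairs index the same Walsh monomial, turning the condition
  \<open>S = T\<close> of orthonormality into one on pairs.\<close>

lemma doubleton_eq_iff_pair:
  "{fst p, snd p} = {fst q, snd q} \<longleftrightarrow> q = p \<or> q = prod.swap p"
  by (cases p; cases q) (auto simp: doubleton_eq_iff)

text \<open>Serves twice: to split the trace part off the quadratic form, and the diagonal off the
  squared Frobenius norm.\<close>

lemma sum_pairs_diagonal:
  fixes f :: "'d::finite \<Rightarrow> 'd \<Rightarrow> 'b::comm_monoid_add"
  shows "(\<Sum>i\<in>UNIV. \<Sum>j\<in>UNIV. f i j)
    = (\<Sum>(i, j) \<in> {(i, j). i \<noteq> j}. f i j) + (\<Sum>i\<in>UNIV. f i i)"
proof -
  have "(\<Sum>i\<in>UNIV. \<Sum>j\<in>UNIV. f i j) = (\<Sum>(i, j) \<in> UNIV. f i j)"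
    by (simp add: sum.cartesian_product)
  also have "\<dots> = (\<Sum>(i, j) \<in> {(i, j). i \<noteq> j} \<union> (\<lambda>i. (i, i)) ` UNIV. f i j)"
    by (rule sum.cong) auto
  also have "\<dots> = (\<Sum>(i, j) \<in> {(i, j). i \<noteq> j}. f i j) + (\<Sum>(i, j) \<in> (\<lambda>i. (i, i)) ` UNIV. f i j)"
    by (rule sum.union_disjoint) auto
  also have "(\<Sum>(i, j) \<in> (\<lambda>i. (i, i)) ` UNIV. f i j) = (\<Sum>i\<in>UNIV. f i i)"
    by (subst sum.reindex) (auto simp: inj_on_def)
  finally show ?thesis .
qed

theorem theorem6p1:
  fixes M :: "real ^ 'd ^ 'd" and P :: "'a measure" and z :: "'a \<Rightarrow> real ^ 'd"
  assumes "prob_space P"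
    and "transpose M = M"
    and "rademacher_vector P z"
  shows "prob_space.variance P (\<lambda>\<omega>. z \<omega> \<bullet> (M *v z \<omega>))
           = 2 * (\<Sum>(i, j) \<in> {(i, j). i \<noteq> j}. (M $ i $ j)\<^sup>2) \<and>
         2 * (\<Sum>(i, j) \<in> {(i, j). i \<noteq> j}. (M $ i $ j)\<^sup>2)
           = 2 * ((frobenius_norm M)\<^sup>2 - (\<Sum>i\<in>UNIV. (M $ i $ i)\<^sup>2))"
proof
  interpret prob_space P by fact
  have rad: "rademacher P (\<lambda>\<omega>. z \<omega> $ i)" for i
    using assms by (simp add: rademacher_vector_def)
  have indep: "indep_vars (\<lambda>_. borel) (\<lambda>i \<omega>. z \<omega> $ i) UNIV"
    using assms by (simp add: rademacher_vector_def)
  have [measurable]: "(\<lambda>\<omega>. z \<omega> $ i) \<in> borel_measurable P" for i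
    using rad by (simp add: rademacher_def)
  define D where "D = {(i, j). i \<noteq> (j :: 'd)}"
  define m where "m p = M $ fst p $ snd p" for p
  \<comment> \<open>For a diagonal pair the index set collapses to a singleton and
    \<open>w p\<close> is a single entry, not its square. The set is never empty, so
    \<open>w p\<close> has mean 0 for every \<open>p\<close>; the expansion of \<open>?Q\<close>
    uses only \<open>p\<close> in \<open>D\<close>.\<close>
  define w where "w p \<omega> = (\<Prod>i\<in>{fst p, snd p}. z \<omega> $ i)" for p \<omega>
  define t where "t = (\<Sum>i\<in>UNIV. M $ i $ i)"
  let ?Q = "\<lambda>\<omega>. z \<omega> \<bullet> (M *v z \<omega>)"
  have w_int: "integrable P (w p)" for p
    unfolding w_def by (rule walsh_integrable) (auto intro: rad)
  have w_exp: "expectation (w p) = 0" for p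
    unfolding w_def
    using walsh_expectation[OF indep_vars_subset[OF indep subset_UNIV] rad, of "{fst p, snd p}"]
    by simp
  have ww_int: "integrable P (\<lambda>\<omega>. w p \<omega> * w q \<omega>)" for p q
    unfolding w_def
    by (rule walsh_orthonormal(1)[OF indep_vars_subset[OF indep subset_UNIV] rad]) auto
  have ww_exp: "expectation (\<lambda>\<omega>. w p \<omega> * w q \<omega>) = (if q = p \<or> q = prod.swap p then 1 else 0)"
    for p q
    unfolding w_def
    by (subst walsh_orthonormal(2)[OF indep_vars_subset[OF indep subset_UNIV] rad])
      (auto simp: doubleton_eq_iff_pair)
  have Q_eq: "?Q \<omega> = (\<Sum>i\<in>UNIV. \<Sum>j\<in>UNIV. M $ i $ j * (z \<omega> $ i * z \<omega> $ j))" for \<omega>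
    by (simp add: inner_vec_def matrix_vector_mult_def sum_distrib_left mult_ac)
  have Q_meas [measurable]: "?Q \<in> borel_measurable P"
    unfolding Q_eq by measurable
  have "AE \<omega> in P. \<forall>i\<in>UNIV. z \<omega> $ i = 1 \<or> z \<omega> $ i = -1"
    by (intro AE_finite_allI rademacher_AE rad) auto
  then have Q_AE: "AE \<omega> in P. ?Q \<omega> = (\<Sum>p\<in>D. m p * w p \<omega>) + t"
  proof eventually_elim
    fix \<omega>
    assume sgn: "\<forall>i\<in>UNIV. z \<omega> $ i = 1 \<or> z \<omega> $ i = -1"
    \<comment> \<open>The diagonal terms thus lose their randomness and add up to the constant
      \<open>t\<close>.\<close>
    have "z \<omega> $ i * z \<omega> $ i = 1" for i
      using sgn[rule_format, of i] by auto
    then show "?Q \<omega> = (\<Sum>p\<in>D. m p * w p \<omega>) + t"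
      unfolding Q_eq sum_pairs_diagonal t_def D_def m_def w_def
      by (auto intro!: sum.cong)
  qed
  have [measurable]: "w p \<in> borel_measurable P" for p
    using w_int by (rule borel_measurable_integrable)
  have "expectation ?Q = expectation (\<lambda>\<omega>. (\<Sum>p\<in>D. m p * w p \<omega>) + t)"
    using Q_AE by (intro integral_cong_AE) auto
  also have "\<dots> = t"
    by (simp add: w_int w_exp prob_space)
  finally have Q_exp: "expectation ?Q = t" .
  \<comment> \<open>Centring removes \<open>t\<close>, the mean of \<open>?Q\<close>, and the square
    of the remaining sum expands into a double sum over \<open>D\<close>.\<close>
  have "variance ?Q = expectation (\<lambda>\<omega>. \<Sum>p\<in>D. \<Sum>q\<in>D. m p * m q * (w p \<omega> * w q \<omega>))"
  proof (rule integral_cong_AE)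
    show "AE \<omega> in P. (?Q \<omega> - expectation ?Q)\<^sup>2
        = (\<Sum>p\<in>D. \<Sum>q\<in>D. m p * m q * (w p \<omega> * w q \<omega>))"
      using Q_AE unfolding Q_exp
      by eventually_elim (simp add: power2_eq_square sum_product mult_ac)
  qed auto
  also have "\<dots> = (\<Sum>p\<in>D. \<Sum>q\<in>D. m p * m q * (if q = p \<or> q = prod.swap p then 1 else 0))"
    by (simp add: ww_int ww_exp)
  also have "\<dots> = (\<Sum>p\<in>D. 2 * (m p)\<^sup>2)"
  proof (rule sum.cong)
    fix p
    assume p: "p \<in> D"
    have "m (prod.swap p) = m p"
      using arg_cong[OF assms(2), of "\<lambda>A. A $ fst p $ snd p"]
      by (simp add: m_def transpose_def)
    \<comment> \<open>Off the diagonal, \<open>p\<close> and its swap are distinct members of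
      \<open>D\<close>, so exactly two terms of the inner sum survive. By symmetry of
      \<open>M\<close> both equal \<open>(m p)\<^sup>2\<close>.\<close>
    moreover have "p \<noteq> prod.swap p" "{p, prod.swap p} \<subseteq> D"
      using p by (auto simp: D_def prod_eq_iff)
    moreover have "(\<Sum>q\<in>D. m p * m q * (if q = p \<or> q = prod.swap p then 1 else 0))
        = (\<Sum>q\<in>{p, prod.swap p}. m p * m q)"
      using \<open>{p, prod.swap p} \<subseteq> D\<close> by (intro sum.mono_neutral_cong_right) auto
    ultimately show "(\<Sum>q\<in>D. m p * m q * (if q = p \<or> q = prod.swap p then 1 else 0))
        = 2 * (m p)\<^sup>2"
      by (simp add: power2_eq_square)
  qed simp
  finally show "variance ?Q = 2 * (\<Sum>(i, j) \<in> {(i, j). i \<noteq> j}. (M $ i $ j)\<^sup>2)"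
    by (simp add: D_def m_def sum_distrib_left case_prod_unfold)
  have "(frobenius_norm M)\<^sup>2 = (\<Sum>i\<in>UNIV. \<Sum>j\<in>UNIV. (M $ i $ j)\<^sup>2)"
    by (simp add: frobenius_norm_def sum_nonneg)
  then show "2 * (\<Sum>(i, j) \<in> {(i, j). i \<noteq> j}. (M $ i $ j)\<^sup>2)
      = 2 * ((frobenius_norm M)\<^sup>2 - (\<Sum>i\<in>UNIV. (M $ i $ i)\<^sup>2))"
    by (simp add: sum_pairs_diagonal)
qed

end
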